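(* Let $A$ be an associative conformal algebra and $Q$ a $\mathbb{C}[\partial]$-module. Set $E=A\oplus Q$, the direct sum of $\mathbb{C}[\partial]$-modules. Let $\mathcal{TC}(A,Q)$ be the set of all associative conformal extending structures of $A$ by $Q$. Then: (1) With $\mathcal{AH}_A^2(Q,A):=\mathcal{TC}(A,Q)/\equiv$, the map $$\mathcal{AH}_A^2(Q,A)\to \mathrm{CExtd}(E,A),\qquad \overline{\Omega(A,Q)}\mapsto (A\natural Q,\ \cdot_\lambda\cdot)$$ is bijective, where $\overline{\Omega(A,Q)}$ is the equivalence class of $\Omega(A,Q)$ under $\equiv$, and $A\natural Q$ is the unified product associated with $\Omega(A,Q)$ (regarded as an associative conformal algebra structure on $E$, up to equivalence). (2) With $\mathcal{AH}^2(Q,A):=\mathcal{TC}(A,Q)/\approx$, the map $$\mathcal{AH}^2(Q,A)\to \mathrm{CExtd}'(E,A),\qquad \overline{\overline{\Omega(A,Q)}}\mapsto (A\natural Q,\ \cdot_\lambda\cdot)$$ is bijective, where $\overline{\overline{\Omega(A,Q)}}$ is the equivalence class of $\Omega(A,Q)$ under $\approx$.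
   Context: An associative conformal algebra is a $\mathbb{C}[\partial]$-module $A$ with a $\mathbb{C}$-bilinear $\lambda$-product $A\times A\to A[\lambda]$, $(a,b)\mapsto a_\lambda b$, such that $(\partial a)_\lambda b=-\lambda a_\lambda b$, $a_\lambda\partial b=(\lambda+\partial)a_\lambda b$ and $a_\lambda(b_\mu c)=(a_\lambda b)_{\lambda+\mu}c$. Here and below all maps are extended coefficientwise to polynomials in $\lambda,\mu$. Homomorphisms and subalgebras are defined as usual. A conformal bilinear map $f_\lambda:U\times V\to W[\lambda]$ between $\mathbb{C}[\partial]$-modules is a $\mathbb{C}$-bilinear map with $f_\lambda(\partial u,v)=-\lambda f_\lambda(u,v)$, $f_\lambda(u,\partial v)=(\partial+\lambda)f_\lambda(u,v)$. An extending datum of $A$ by $Q$ is a system $\Omega(A,Q)=(\leftharpoonup_\lambda,\rightharpoonup_\lambda,\lhd_\lambda,\rhd_\lambda,f_\lambda,\circ_\lambda)$ of six conformal bilinear maps $\leftharpoonup_\lambda:A\times Q\to A[\lambda]$, $\rightharpoonup_\lambda:A\times Q\to Q[\lambda]$, $\lhd_\lambda:Q\times A\to Q[\lambda]$, $\rhd_\lambda:Q\times A\to A[\lambda]$, $f_\lambda:Q\times Q\to A[\lambda]$, $\circ_\lambda:Q\times Q\to Q[\lambda]$. On the $\mathbb{C}[\partial]$-module $A\times Q$ (identified with $A\oplus Q$) it defines the $\lambda$-product $$(a,x)_\lambda(b,y)=(a_\lambda b+a\leftharpoonup_\lambda y+x\rhd_\lambda b+f_\lambda(x,y),\ a\rightharpoonup_\lambda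 y+x\lhd_\lambda b+x\circ_\lambda y).$$ If this makes $A\times Q$ an associative conformal algebra, it is called the unified product $A\natural Q$ and $\Omega(A,Q)$ is called an associative conformal extending structure of $A$ by $Q$. Two associative conformal extending structures $\Omega(A,Q)$ and $\Omega'(A,Q)=(\leftharpoonup'_\lambda,\rightharpoonup'_\lambda,\lhd'_\lambda,\rhd'_\lambda,f'_\lambda,\circ'_\lambda)$ are equivalent, $\Omega(A,Q)\equiv\Omega'(A,Q)$, if there are a $\mathbb{C}[\partial]$-module homomorphism $u:Q\to A$ and $v\in\mathrm{Aut}_{\mathbb{C}[\partial]}(Q)$ such that for all $a\in A$, $x,y\in Q$: - $a\rightharpoonup_\lambda x=v^{-1}(a\rightharpoonup'_\lambda v(x))$, - $a\leftharpoonup_\lambda x=a_\lambda u(x)+a\leftharpoonup'_\lambda v(x)-u(a\rightharpoonup_\lambda x)$, - $x\lhd_\lambda a=v^{-1}(v(x)\lhd'_\lambda a)$, - $x\rhd_\lambda a=u(x)_\lambda a+v(x)\rhd'_\lambda a-u(x\lhd_\lambda a)$, - $x\circ_\lambda y=v^{-1}(u(x)\rightharpoonup'_\lambda v(y))+v^{-1}(v(x)\lhd'_\lambda u(y))+v^{-1}(v(x)\circ'_\lambda v(y))$, - $f_\lambda(x,y)=u(x)_\lambda u(y)+u(x)\leftharpoonup'_\lambda v(y)+v(x)\rhd'_\lambda u(y)+f'_\lambda(v(x),v(y))-u(x\circ_\lambda y)$. They are cohomologous, $\Omega(A,Q)\approx\Omega'(A,Q)$, if this holds with $v=\mathrm{Id}_Q$.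 A $\mathbb{C}[\partial]$-module homomorphism $\varphi:E\to E$ stabilizes $A$ if $\varphi|_A=\mathrm{id}_A$, and co-stabilizes $Q$ if $\pi\circ\varphi=\pi$, where $\pi:E=A\oplus Q\to Q$ is the projection. On the set of all associative conformal algebra structures on $E$ containing $A$ as a subalgebra, two structures are equivalent ($\equiv$) if there is an isomorphism of associative conformal algebras between them that stabilizes $A$, and cohomologous ($\approx$) if there is one that stabilizes $A$ and co-stabilizes $Q$. The sets of equivalence classes are $\mathrm{CExtd}(E,A)$ (for $\equiv$) and $\mathrm{CExtd}'(E,A)$ (for $\approx$). *)

theory Defs
  imports "HOL-Computational_Algebra.Polynomial" "HOL-Analysis.Product_Vector"
begin

(* A C[d]-module is a module over the ring "complex poly" in the sense of HOL.Modules, given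
   by its scalar action s.  The complex scalar c acts as s [:c:] and d acts as s [:0, 1:].
   For an additive group V, the type "V poly" is V[lambda], where pCons 0 is multiplication by
   lambda and map_poly is coefficientwise extension.  "V poly poly" is V[lambda, mu]: the inner
   polynomials are in lambda, the outer ones in mu. *)

definition dd :: "(complex poly \<Rightarrow> 'v \<Rightarrow> 'v) \<Rightarrow> 'v \<Rightarrow> 'v"
  where "dd s = s [:0, 1:]"

definition conformal_bilinear ::
  "(complex poly \<Rightarrow> 'u::ab_group_add \<Rightarrow> 'u) \<Rightarrow> (complex poly \<Rightarrow> 'v::ab_group_add \<Rightarrow> 'v) \<Rightarrow>
   (complex poly \<Rightarrow> 'w::ab_group_add \<Rightarrow> 'w) \<Rightarrow> ('u \<Rightarrow> 'v \<Rightarrow> 'w poly) \<Rightarrow> bool"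
  where "conformal_bilinear sU sV sW f \<longleftrightarrow>
    (\<forall>v. module_hom (\<lambda>c. sU [:c:]) (\<lambda>c. map_poly (sW [:c:])) (\<lambda>u. f u v)) \<and>
    (\<forall>u. module_hom (\<lambda>c. sV [:c:]) (\<lambda>c. map_poly (sW [:c:])) (\<lambda>v. f u v)) \<and>
    (\<forall>u v. f (dd sU u) v = - pCons 0 (f u v)) \<and>
    (\<forall>u v. f u (dd sV v) = map_poly (dd sW) (f u v) + pCons 0 (f u v))"

definition times_lam :: "'v::ab_group_add poly poly \<Rightarrow> 'v poly poly"
  where "times_lam = map_poly (pCons 0)"

definition times_mu :: "'v::ab_group_add poly poly \<Rightarrow> 'v poly poly"
  where "times_mu = pCons 0"

(* p(lambda + mu) *)
definition at_sum :: "'v::ab_group_add poly \<Rightarrow> 'v poly poly"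
  where "at_sum p = (\<Sum>k\<le>degree p. ((\<lambda>q. times_lam q + times_mu q) ^^ k) [:[:coeff p k:]:])"

(* a_lambda (b_mu c) *)
definition prod_right :: "('a \<Rightarrow> 'a \<Rightarrow> 'a poly) \<Rightarrow> 'a::ab_group_add \<Rightarrow> 'a \<Rightarrow> 'a \<Rightarrow> 'a poly poly"
  where "prod_right m a b c = map_poly (m a) (m b c)"

(* (a_lambda b)_{lambda + mu} c *)
definition prod_left :: "('a \<Rightarrow> 'a \<Rightarrow> 'a poly) \<Rightarrow> 'a::ab_group_add \<Rightarrow> 'a \<Rightarrow> 'a \<Rightarrow> 'a poly poly"
  where "prod_left m a b c =
    (\<Sum>i\<le>degree (m a b). (times_lam ^^ i) (at_sum (m (coeff (m a b) i) c)))"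

definition assoc_conformal_algebra ::
  "(complex poly \<Rightarrow> 'a::ab_group_add \<Rightarrow> 'a) \<Rightarrow> ('a \<Rightarrow> 'a \<Rightarrow> 'a poly) \<Rightarrow> bool"
  where "assoc_conformal_algebra s m \<longleftrightarrow>
    module s \<and> conformal_bilinear s s s m \<and>
    (\<forall>a b c. prod_right m a b c = prod_left m a b c)"

(* The fields are, in order, the left and right harpoon, the left and right triangle, f, and o. *)
record (overloaded) ('a::zero, 'q::zero) ext_datum =
  lharp :: "'a \<Rightarrow> 'q \<Rightarrow> 'a poly"
  rharp :: "'a \<Rightarrow> 'q \<Rightarrow> 'q poly"
  ltri :: "'q \<Rightarrow> 'a \<Rightarrow> 'q poly"
  rtri :: "'q \<Rightarrow> 'a \<Rightarrow> 'a poly"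
  cocyc :: "'q \<Rightarrow> 'q \<Rightarrow> 'a poly"
  circ :: "'q \<Rightarrow> 'q \<Rightarrow> 'q poly"

definition extending_datum ::
  "(complex poly \<Rightarrow> 'a::ab_group_add \<Rightarrow> 'a) \<Rightarrow> (complex poly \<Rightarrow> 'q::ab_group_add \<Rightarrow> 'q) \<Rightarrow>
   ('a, 'q) ext_datum \<Rightarrow> bool"
  where "extending_datum sA sQ W \<longleftrightarrow>
    conformal_bilinear sA sQ sA (lharp W) \<and>
    conformal_bilinear sA sQ sQ (rharp W) \<and>
    conformal_bilinear sQ sA sQ (ltri W) \<and>
    conformal_bilinear sQ sA sA (rtri W) \<and>
    conformal_bilinear sQ sQ sA (cocyc W) \<and>
    conformal_bilinear sQ sQ sQ (circ W)"

(* The identification of A[lambda] x Q[lambda] with (A x Q)[lambda]. *)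
definition pair_poly :: "'a::ab_group_add poly \<Rightarrow> 'q::ab_group_add poly \<Rightarrow> ('a \<times> 'q) poly"
  where "pair_poly p q = map_poly (\<lambda>a. (a, 0)) p + map_poly (\<lambda>x. (0, x)) q"

definition unified_product ::
  "('a \<Rightarrow> 'a \<Rightarrow> 'a poly) \<Rightarrow> ('a::ab_group_add, 'q::ab_group_add) ext_datum \<Rightarrow>
   'a \<times> 'q \<Rightarrow> 'a \<times> 'q \<Rightarrow> ('a \<times> 'q) poly"
  where "unified_product m W = (\<lambda>(a, x) (b, y).
    pair_poly (m a b + lharp W a y + rtri W x b + cocyc W x y)
              (rharp W a y + ltri W x b + circ W x y))"

definition TC ::
  "(complex poly \<Rightarrow> 'a::ab_group_add \<Rightarrow> 'a) \<Rightarrow> ('a \<Rightarrow> 'a \<Rightarrow> 'a poly) \<Rightarrow>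
   (complex poly \<Rightarrow> 'q::ab_group_add \<Rightarrow> 'q) \<Rightarrow> ('a, 'q) ext_datum set"
  where "TC sA m sQ =
    {W. extending_datum sA sQ W \<and>
        assoc_conformal_algebra (module_prod.scale sA sQ) (unified_product m W)}"

definition equivalent_via ::
  "('a \<Rightarrow> 'a \<Rightarrow> 'a poly) \<Rightarrow> ('q \<Rightarrow> 'a) \<Rightarrow> ('q \<Rightarrow> 'q) \<Rightarrow>
   ('a::ab_group_add, 'q::ab_group_add) ext_datum \<Rightarrow> ('a, 'q) ext_datum \<Rightarrow> bool"
  where "equivalent_via m u v W W' \<longleftrightarrow>
    (\<forall>a x. rharp W a x = map_poly (inv v) (rharp W' a (v x))) \<and>
    (\<forall>a x. lharp W a x = m a (u x) + lharp W' a (v x) - map_poly u (rharp W a x)) \<and>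
    (\<forall>x a. ltri W x a = map_poly (inv v) (ltri W' (v x) a)) \<and>
    (\<forall>x a. rtri W x a = m (u x) a + rtri W' (v x) a - map_poly u (ltri W x a)) \<and>
    (\<forall>x y. circ W x y = map_poly (inv v) (rharp W' (u x) (v y))
                      + map_poly (inv v) (ltri W' (v x) (u y))
                      + map_poly (inv v) (circ W' (v x) (v y))) \<and>
    (\<forall>x y. cocyc W x y = m (u x) (u y) + lharp W' (u x) (v y) + rtri W' (v x) (u y)
                       + cocyc W' (v x) (v y) - map_poly u (circ W x y))"

definition equiv_rel ::
  "(complex poly \<Rightarrow> 'a::ab_group_add \<Rightarrow> 'a) \<Rightarrow> ('a \<Rightarrow> 'a \<Rightarrow> 'a poly) \<Rightarrow>
   (complex poly \<Rightarrow> 'q::ab_group_add \<Rightarrow> 'q) \<Rightarrow> ('a, 'q) ext_datum rel"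
  where "equiv_rel sA m sQ =
    {(W, W'). W \<in> TC sA m sQ \<and> W' \<in> TC sA m sQ \<and>
      (\<exists>u v. module_hom sQ sA u \<and> module_hom sQ sQ v \<and> bij v \<and> equivalent_via m u v W W')}"

definition cohom_rel ::
  "(complex poly \<Rightarrow> 'a::ab_group_add \<Rightarrow> 'a) \<Rightarrow> ('a \<Rightarrow> 'a \<Rightarrow> 'a poly) \<Rightarrow>
   (complex poly \<Rightarrow> 'q::ab_group_add \<Rightarrow> 'q) \<Rightarrow> ('a, 'q) ext_datum rel"
  where "cohom_rel sA m sQ =
    {(W, W'). W \<in> TC sA m sQ \<and> W' \<in> TC sA m sQ \<and>
      (\<exists>u. module_hom sQ sA u \<and> equivalent_via m u id W W')}"

definition conformal_hom ::
  "(complex poly \<Rightarrow> 'a::ab_group_add \<Rightarrow> 'a) \<Rightarrow> ('a \<Rightarrow> 'a \<Rightarrow> 'a poly) \<Rightarrow>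
   (complex poly \<Rightarrow> 'b::ab_group_add \<Rightarrow> 'b) \<Rightarrow> ('b \<Rightarrow> 'b \<Rightarrow> 'b poly) \<Rightarrow> ('a \<Rightarrow> 'b) \<Rightarrow> bool"
  where "conformal_hom s m s' m' h \<longleftrightarrow>
    module_hom s s' h \<and> (\<forall>x y. map_poly h (m x y) = m' (h x) (h y))"

(* Structures on the C[d]-module E = A x Q containing A x 0, with the product of A, as a subalgebra *)
definition structures ::
  "(complex poly \<Rightarrow> 'a::ab_group_add \<Rightarrow> 'a) \<Rightarrow> ('a \<Rightarrow> 'a \<Rightarrow> 'a poly) \<Rightarrow>
   (complex poly \<Rightarrow> 'q::ab_group_add \<Rightarrow> 'q) \<Rightarrow> ('a \<times> 'q \<Rightarrow> 'a \<times> 'q \<Rightarrow> ('a \<times> 'q) poly) set"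
  where "structures sA m sQ =
    {n. assoc_conformal_algebra (module_prod.scale sA sQ) n \<and>
        (\<forall>a b. n (a, 0) (b, 0) = map_poly (\<lambda>c. (c, 0)) (m a b))}"

definition stabilizes :: "('a \<times> 'q::zero \<Rightarrow> 'a \<times> 'q) \<Rightarrow> bool"
  where "stabilizes h \<longleftrightarrow> (\<forall>a. h (a, 0) = (a, 0))"

definition co_stabilizes :: "('a \<times> 'q \<Rightarrow> 'a \<times> 'q) \<Rightarrow> bool"
  where "co_stabilizes h \<longleftrightarrow> snd \<circ> h = snd"

definition struct_equiv_rel ::
  "(complex poly \<Rightarrow> 'a::ab_group_add \<Rightarrow> 'a) \<Rightarrow> ('a \<Rightarrow> 'a \<Rightarrow> 'a poly) \<Rightarrow>
   (complex poly \<Rightarrow> 'q::ab_group_add \<Rightarrow> 'q) \<Rightarrow>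
   ('a \<times> 'q \<Rightarrow> 'a \<times> 'q \<Rightarrow> ('a \<times> 'q) poly) rel"
  where "struct_equiv_rel sA m sQ =
    {(n, n'). n \<in> structures sA m sQ \<and> n' \<in> structures sA m sQ \<and>
      (\<exists>h. conformal_hom (module_prod.scale sA sQ) n (module_prod.scale sA sQ) n' h \<and> bij h \<and>
           stabilizes h)}"

definition struct_cohom_rel ::
  "(complex poly \<Rightarrow> 'a::ab_group_add \<Rightarrow> 'a) \<Rightarrow> ('a \<Rightarrow> 'a \<Rightarrow> 'a poly) \<Rightarrow>
   (complex poly \<Rightarrow> 'q::ab_group_add \<Rightarrow> 'q) \<Rightarrow>
   ('a \<times> 'q \<Rightarrow> 'a \<times> 'q \<Rightarrow> ('a \<times> 'q) poly) rel"
  where "struct_cohom_rel sA m sQ =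
    {(n, n'). n \<in> structures sA m sQ \<and> n' \<in> structures sA m sQ \<and>
      (\<exists>h. conformal_hom (module_prod.scale sA sQ) n (module_prod.scale sA sQ) n' h \<and> bij h \<and>
           stabilizes h \<and> co_stabilizes h)}"

definition AH2_A ::
  "(complex poly \<Rightarrow> 'a::ab_group_add \<Rightarrow> 'a) \<Rightarrow> ('a \<Rightarrow> 'a \<Rightarrow> 'a poly) \<Rightarrow>
   (complex poly \<Rightarrow> 'q::ab_group_add \<Rightarrow> 'q) \<Rightarrow> ('a, 'q) ext_datum set set"
  where "AH2_A sA m sQ = TC sA m sQ // equiv_rel sA m sQ"

definition AH2 ::
  "(complex poly \<Rightarrow> 'a::ab_group_add \<Rightarrow> 'a) \<Rightarrow> ('a \<Rightarrow> 'a \<Rightarrow> 'a poly) \<Rightarrow>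
   (complex poly \<Rightarrow> 'q::ab_group_add \<Rightarrow> 'q) \<Rightarrow> ('a, 'q) ext_datum set set"
  where "AH2 sA m sQ = TC sA m sQ // cohom_rel sA m sQ"

definition CExtd ::
  "(complex poly \<Rightarrow> 'a::ab_group_add \<Rightarrow> 'a) \<Rightarrow> ('a \<Rightarrow> 'a \<Rightarrow> 'a poly) \<Rightarrow>
   (complex poly \<Rightarrow> 'q::ab_group_add \<Rightarrow> 'q) \<Rightarrow>
   ('a \<times> 'q \<Rightarrow> 'a \<times> 'q \<Rightarrow> ('a \<times> 'q) poly) set set"
  where "CExtd sA m sQ = structures sA m sQ // struct_equiv_rel sA m sQ"

definition CExtd' ::
  "(complex poly \<Rightarrow> 'a::ab_group_add \<Rightarrow> 'a) \<Rightarrow> ('a \<Rightarrow> 'a \<Rightarrow> 'a poly) \<Rightarrow>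
   (complex poly \<Rightarrow> 'q::ab_group_add \<Rightarrow> 'q) \<Rightarrow>
   ('a \<times> 'q \<Rightarrow> 'a \<times> 'q \<Rightarrow> ('a \<times> 'q) poly) set set"
  where "CExtd' sA m sQ = structures sA m sQ // struct_cohom_rel sA m sQ"

end

theory Submission
  imports Defs
begin

text \<open>
  An associative conformal structure on \<open>A \<times> Q\<close> containing \<open>A\<close> is determined by its restrictions
  to the four pairs of summands, and the components of these restrictions other than the product of
  \<open>A\<close> form an extending structure; so \<open>W \<mapsto> unified_product m W\<close> is a bijection from \<open>TC\<close> to the
  set of structures.  A module endomorphism of \<open>A \<times> Q\<close> stabilizing \<open>A\<close> has the form
  \<open>(a, x) \<mapsto> (a + u x, v x)\<close>, is bijective iff \<open>v\<close> is, and co-stabilizes \<open>Q\<close> iff \<open>v = id\<close>.  By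
  biadditivity it is multiplicative iff it is so on the four pairs of summands, which are the
  conditions in \<open>equivalent_via\<close>.  Hence the two relations on \<open>TC\<close> are the pullbacks of those on
  structures, and both bijections between the sets of classes follow.
\<close>

section \<open>Transport of an equivalence relation along a bijection\<close>

text \<open>Since \<open>S\<close> is the preimage of \<open>R\<close> under \<open>f\<close>,
  \<open>S\<close> inherits the equivalence axioms, and related elements correspond in both
  directions: this makes the induced map on classes well defined and injective. Its surjectivity
  comes from that of \<open>f\<close>.\<close>

lemma equiv_pullback_bij_betw:
  assumes f: "bij_betw f A B" and R: "equiv B R"
    and S: "S = {(x, y). x \<in> A \<and> y \<in> A \<and> (f x, f y) \<in> R}"
  shows "equiv A S"
    and "\<exists>F. (\<forall>x\<in>A. F (S `` {x}) = R `` {f x}) \<and> bij_betw F (A // S) (B // R)"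
proof -
  have fB: "f x \<in> B" if "x \<in> A" for x
    using f that by (rule bij_betw_apply)
  have S_iff: "(x, y) \<in> S \<longleftrightarrow> x \<in> A \<and> y \<in> A \<and> (f x, f y) \<in> R" for x y
    by (simp add: S)
  show E: "equiv A S"
  proof (rule equivI)
    show "S \<subseteq> A \<times> A"
      by (auto simp: S_iff)
    show "refl_on A S"
      using R fB by (simp add: S_iff equiv_def refl_on_def)
    show "sym S"
      by (rule symI) (metis S_iff R equivE symD)
    show "trans S"
      by (rule transI) (metis S_iff R equivE transD)
  qed
  \<comment> \<open>The \<open>R\<close>-saturation of the image of the class, which avoids choosing
    a representative.\<close>
  define F where "F C = R `` (f ` C)" for C
  have F: "F (S `` {x}) = R `` {f x}" if x: "x \<in> A" for x
  proof -
    have eq: "R `` {f y} = R `` {f x}" if "y \<in> S `` {x}" for y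
    proof -
      have "(f x, f y) \<in> R"
        using that by (simp add: S_iff)
      then show ?thesis
        by (rule equiv_class_eq[OF R, symmetric])
    qed
    have "F (S `` {x}) = (\<Union>y\<in>S `` {x}. R `` {f y})"
      unfolding F_def by blast
    also have "\<dots> = (\<Union>y\<in>S `` {x}. R `` {f x})"
      by (rule SUP_cong[OF refl]) (rule eq)
    also have "\<dots> = R `` {f x}"
      using equiv_class_self[OF E x] by blast
    finally show ?thesis .
  qed
  have "inj_on F (A // S)"
  proof (rule inj_onI)
    fix C D assume "C \<in> A // S" "D \<in> A // S" and eq: "F C = F D"
    then obtain x y where x: "x \<in> A" "C = S `` {x}" and y: "y \<in> A" "D = S `` {y}"
      by (auto simp: quotient_def)
    have "(f x, f y) \<in> R"
      using eq F[OF x(1)] F[OF y(1)] x(2) y(2) by (intro eq_equiv_class[OF _ R fB[OF y(1)]]) simp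
    then have "(x, y) \<in> S"
      using x y by (simp add: S_iff)
    then show "C = D"
      using x(2) y(2) equiv_class_eq[OF E] by simp
  qed
  moreover have "F ` (A // S) = B // R"
  proof -
    have A: "A // S = (\<lambda>x. S `` {x}) ` A" and B: "B // R = (\<lambda>y. R `` {y}) ` B"
      unfolding quotient_def by blast+
    have "F ` (A // S) = (\<lambda>x. R `` {f x}) ` A"
      unfolding A image_image by (rule image_cong[OF refl]) (rule F)
    also have "\<dots> = (\<lambda>y. R `` {y}) ` (f ` A)"
      by (simp add: image_image)
    also have "\<dots> = B // R"
      unfolding B using f by (simp add: bij_betw_def)
    finally show ?thesis .
  qed
  ultimately show "\<exists>F. (\<forall>x\<in>A. F (S `` {x}) = R `` {f x}) \<and> bij_betw F (A // S) (B // R)"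
    using F unfolding bij_betw_def by blast
qed

section \<open>Polynomials with coefficients in a module\<close>

lemma map_poly_add_hom:
  assumes "\<And>x y. h (x + y) = h x + h y" and "h 0 = 0"
  shows "map_poly h (p + q) = map_poly h p + map_poly h q"
  by (rule poly_eqI) (simp add: coeff_map_poly assms)

lemma map_poly_minus_hom:
  assumes "module_hom s t h"
  shows "map_poly h (- p) = - map_poly h p"
  by (rule poly_eqI) (simp add: coeff_map_poly module_hom.zero[OF assms] module_hom.neg[OF assms])

lemma map_poly_pCons_0: "h 0 = 0 \<Longrightarrow> map_poly h (pCons 0 p) = pCons 0 (map_poly h p)"
  by (simp add: map_poly_pCons)

lemma map_poly_comp_eq:
  "f 0 = 0 \<Longrightarrow> g 0 = 0 \<Longrightarrow> map_poly f (map_poly g p) = map_poly (\<lambda>x. f (g x)) p"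
  by (simp add: map_poly_map_poly o_def)

text \<open>Serves to remove \<open>inv v\<close> from equations between polynomials. The condition
  \<open>v 0 = 0\<close> lets \<open>map_poly\<close> act coefficient by coefficient, vanishing
  coefficients included.\<close>

lemma map_poly_inv_eq_iff:
  assumes "bij v" "v 0 = 0"
  shows "p = map_poly (inv v) q \<longleftrightarrow> map_poly v p = q"
proof -
  have "inv v 0 = 0"
    using assms by (metis bij_is_inj inv_f_f)
  moreover have "x = inv v y \<longleftrightarrow> v x = y" for x y
    using bij_inv_eq_iff[OF \<open>bij v\<close>] by metis
  ultimately show ?thesis
    by (simp add: poly_eq_iff coeff_map_poly assms(2))
qed

lemma coeff_pair_poly: "coeff (pair_poly p q) i = (coeff p i, coeff q i)"
  by (simp add: pair_poly_def coeff_map_poly zero_prod_def)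

lemma pair_poly_eq_iff: "pair_poly p q = pair_poly p' q' \<longleftrightarrow> p = p' \<and> q = q'"
  by (auto simp: poly_eq_iff coeff_pair_poly)

lemma pair_poly_components: "pair_poly (map_poly fst r) (map_poly snd r) = r"
  by (rule poly_eqI) (simp add: coeff_pair_poly coeff_map_poly)

lemma map_poly_fst_pair_poly: "map_poly fst (pair_poly p q) = p"
  by (rule poly_eqI) (simp add: coeff_pair_poly coeff_map_poly)

lemma map_poly_snd_pair_poly: "map_poly snd (pair_poly p q) = q"
  by (rule poly_eqI) (simp add: coeff_pair_poly coeff_map_poly)

lemma pair_poly_add: "pair_poly p q + pair_poly p' q' = pair_poly (p + p') (q + q')"
  by (rule poly_eqI) (simp add: coeff_pair_poly)

text \<open>Restriction of scalars along the inclusion of the constants into the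
  polynomials.\<close>

lemma module_constants: "module s \<Longrightarrow> module (\<lambda>c. s [:c:])"
  for s :: "complex poly \<Rightarrow> 'v::ab_group_add \<Rightarrow> 'v"
proof -
  assume s: "module s"
  interpret module s by fact
  show ?thesis
  proof
    fix a b :: complex and x y
    show "s [:a:] (x + y) = s [:a:] x + s [:a:] y"
      by (rule scale_right_distrib)
    show "s [:a + b:] x = s [:a:] x + s [:b:] x"
      using scale_left_distrib[of "[:a:]" "[:b:]" x] by simp
    show "s [:a:] (s [:b:] x) = s [:a * b:] x"
      by (simp add: mult.commute)
    show "s [:1:] x = x"
      by (simp flip: one_pCons)
  qed
qed

lemma module_map_poly:
  assumes "module s"
  shows "module (\<lambda>c. map_poly (s c))"
proof -
  interpret module s by fact
  show ?thesis
    by unfold_locales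
      (auto intro!: poly_eqI simp: coeff_map_poly scale_right_distrib scale_left_distrib)
qed

section \<open>Conformal bilinear maps\<close>

text \<open>\<open>module_hom\<close> includes the module axioms of its source and target. For
  constant scalars, acting coefficientwise on polynomials, these hold automatically, so only
  equations remain.\<close>

lemma conformal_bilinear_iff:
  assumes "module sU" "module sV" "module sW"
  shows "conformal_bilinear sU sV sW f \<longleftrightarrow>
    (\<forall>u u' v. f (u + u') v = f u v + f u' v) \<and>
    (\<forall>u v v'. f u (v + v') = f u v + f u v') \<and>
    (\<forall>c u v. f (sU [:c:] u) v = map_poly (sW [:c:]) (f u v)) \<and>
    (\<forall>c u v. f u (sV [:c:] v) = map_poly (sW [:c:]) (f u v)) \<and>
    (\<forall>u v. f (dd sU u) v = - pCons 0 (f u v)) \<and>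
    (\<forall>u v. f u (dd sV v) = map_poly (dd sW) (f u v) + pCons 0 (f u v))"
  using assms module_map_poly[OF module_constants[OF assms(3)]]
  unfolding conformal_bilinear_def module_hom_iff by (auto simp: module_constants)

lemma conformal_bilinear_add:
  assumes "conformal_bilinear sU sV sW f"
  shows "f (u + u') v = f u v + f u' v" "f u (v + v') = f u v + f u v'"
  using assms by (auto simp: conformal_bilinear_def module_hom_iff)

lemma conformal_bilinear_zero:
  assumes "conformal_bilinear sU sV sW f"
  shows "f 0 v = 0" "f u 0 = 0"
  using conformal_bilinear_add(1)[OF assms, of 0 0 v] conformal_bilinear_add(2)[OF assms, of u 0 0]
  by auto

text \<open>Module homomorphisms commute with constants and with \<open>dd\<close>, so they can be
  inserted in either argument and applied to the values. Taking inclusions for \<open>g\<close>,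
  \<open>h\<close> and a projection for \<open>k\<close> gives the components of a product on the
  direct sum.\<close>

lemma conformal_bilinear_transport:
  assumes f: "conformal_bilinear sU sV sW f"
    and g: "module_hom sU' sU g" and h: "module_hom sV' sV h" and k: "module_hom sW sW' k"
  shows "conformal_bilinear sU' sV' sW' (\<lambda>u v. map_poly k (f (g u) (h v)))"
proof -
  note mods = g[THEN module_hom.axioms(1)] g[THEN module_hom.axioms(2)]
    h[THEN module_hom.axioms(1)] h[THEN module_hom.axioms(2)]
    k[THEN module_hom.axioms(1)] k[THEN module_hom.axioms(2)]
  note F = f[unfolded conformal_bilinear_iff[OF mods(2,4,5)]]
  have s0: "sW c 0 = 0" "sW' c 0 = 0" for c
    using mods by (simp_all add: module.scale_zero_right)
  \<comment> \<open>Constant \<open>c\<close> will give linearity over the complex numbers, and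
    \<open>c = [:0, 1:]\<close> compatibility with \<open>dd\<close>.\<close>
  have scale: "map_poly k (map_poly (sW c) p) = map_poly (sW' c) (map_poly k p)" for c p
    using s0 module_hom.zero[OF k] by (simp add: map_poly_comp_eq module_hom.scale[OF k])
  show ?thesis
    unfolding conformal_bilinear_iff[OF mods(1,3,6)]
    using F scale
    by (simp add: dd_def module_hom.add[OF g] module_hom.add[OF h] module_hom.scale[OF g]
        module_hom.scale[OF h] map_poly_add_hom[OF module_hom.add[OF k] module_hom.zero[OF k]]
        map_poly_minus_hom[OF k] map_poly_pCons_0[of k, OF module_hom.zero[OF k]])
qed

lemma extending_datum_zero:
  assumes "extending_datum sA sQ W"
  shows "lharp W 0 y = 0" "lharp W a 0 = 0" "rharp W 0 y = 0" "rharp W a 0 = 0"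
    "ltri W 0 b = 0" "ltri W x 0 = 0" "rtri W 0 b = 0" "rtri W x 0 = 0"
    "cocyc W 0 y = 0" "cocyc W x 0 = 0" "circ W 0 y = 0" "circ W x 0 = 0"
  using assms unfolding extending_datum_def by (blast dest: conformal_bilinear_zero)+

text \<open>Additivity in the arguments from \<open>A\<close>: a map
  \<open>(a, x) \<mapsto> (a + u x, v x)\<close> creates sums only in the first coordinate.\<close>

lemma extending_datum_add:
  assumes "extending_datum sA sQ W"
  shows "lharp W (a + a') y = lharp W a y + lharp W a' y"
    "rharp W (a + a') y = rharp W a y + rharp W a' y"
    "ltri W x (b + b') = ltri W x b + ltri W x b'"
    "rtri W x (b + b') = rtri W x b + rtri W x b'"
  using assms unfolding extending_datum_def by (blast dest: conformal_bilinear_add)+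

section \<open>Extensions of a conformal algebra by a module\<close>

locale conformal_extension =
  fixes sA :: "complex poly \<Rightarrow> 'a::ab_group_add \<Rightarrow> 'a"
    and sQ :: "complex poly \<Rightarrow> 'q::ab_group_add \<Rightarrow> 'q"
    and m :: "'a \<Rightarrow> 'a \<Rightarrow> 'a poly"
  assumes algebra_A: "assoc_conformal_algebra sA m"
    and module_Q: "module sQ"
begin

abbreviation sE :: "complex poly \<Rightarrow> 'a \<times> 'q \<Rightarrow> 'a \<times> 'q"
  where "sE \<equiv> module_prod.scale sA sQ"

lemma module_A: "module sA"
  using algebra_A by (simp add: assoc_conformal_algebra_def)

sublocale module_prod sA sQ
  using module_A module_Q by (simp add: module_prod_def module_pair_def)

lemma bilinear_A: "conformal_bilinear sA sA sA m"
  using algebra_A by (simp add: assoc_conformal_algebra_def)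

lemma module_hom_inl: "module_hom sA sE (\<lambda>a. (a, 0))"
  by unfold_locales (auto simp: scale_def)

lemma module_hom_inr: "module_hom sQ sE (\<lambda>x. (0, x))"
  by unfold_locales (auto simp: scale_def)

lemma unified_product_in_structures:
  assumes "W \<in> TC sA m sQ"
  shows "unified_product m W \<in> structures sA m sQ"
proof -
  have "extending_datum sA sQ W"
    using assms by (simp add: TC_def)
  then have "unified_product m W (a, 0) (b, 0) = map_poly (\<lambda>c. (c, 0)) (m a b)" for a b
    by (simp add: unified_product_def pair_poly_def extending_datum_zero)
  then show ?thesis
    using assms by (simp add: TC_def structures_def)
qed

text \<open>The inverse of \<open>unified_product m\<close>. The pair \<open>A\<close>,
  \<open>A\<close> is not recorded, because the product of a structure is prescribed there by
  \<open>m\<close>.\<close>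

definition restriction :: "('a \<times> 'q \<Rightarrow> 'a \<times> 'q \<Rightarrow> ('a \<times> 'q) poly) \<Rightarrow> ('a, 'q) ext_datum"
  where "restriction n =
    \<lparr>lharp = \<lambda>a y. map_poly fst (n (a, 0) (0, y)), rharp = \<lambda>a y. map_poly snd (n (a, 0) (0, y)),
     ltri = \<lambda>x b. map_poly snd (n (0, x) (b, 0)), rtri = \<lambda>x b. map_poly fst (n (0, x) (b, 0)),
     cocyc = \<lambda>x y. map_poly fst (n (0, x) (0, y)), circ = \<lambda>x y. map_poly snd (n (0, x) (0, y))\<rparr>"

lemma unified_product_restriction:
  assumes "n \<in> structures sA m sQ"
  shows "unified_product m (restriction n) = n"
proof (intro ext)
  fix p q :: "'a \<times> 'q"
  obtain a x b y where pq: "p = (a, x)" "q = (b, y)"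
    by fastforce
  have bil: "conformal_bilinear sE sE sE n"
    using assms by (simp add: structures_def assoc_conformal_algebra_def)
  have "n p q = n ((a, 0) + (0, x)) ((b, 0) + (0, y))"
    by (simp add: pq)
  also have "\<dots> = n (a, 0) (b, 0) + n (a, 0) (0, y) + n (0, x) (b, 0) + n (0, x) (0, y)"
    by (simp only: conformal_bilinear_add[OF bil] ac_simps)
  also have "n (a, 0) (b, 0) = pair_poly (m a b) 0"
    using assms by (simp add: structures_def pair_poly_def)
  also have "n (a, 0) (0, y) = pair_poly (lharp (restriction n) a y) (rharp (restriction n) a y)"
    by (simp add: restriction_def pair_poly_components)
  also have "n (0, x) (b, 0) = pair_poly (rtri (restriction n) x b) (ltri (restriction n) x b)"
    by (simp add: restriction_def pair_poly_components)
  also have "n (0, x) (0, y) = pair_poly (cocyc (restriction n) x y) (circ (restriction n) x y)"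
    by (simp add: restriction_def pair_poly_components)
  finally show "unified_product m (restriction n) p q = n p q"
    by (simp add: pq unified_product_def pair_poly_add)
qed

text \<open>On each mixed pair of summands, and on \<open>Q\<close>, \<open>Q\<close>, every term
  but one in each component of the unified product has a zero argument.\<close>

lemma restriction_unified_product:
  assumes "extending_datum sA sQ W"
  shows "restriction (unified_product m W) = W"
  using assms
  by (intro ext_datum.equality ext)
    (simp_all add: restriction_def unified_product_def map_poly_fst_pair_poly
      map_poly_snd_pair_poly extending_datum_zero
      conformal_bilinear_zero[OF bilinear_A])

text \<open>Associativity needs no identities between the six maps: the unified product of the
  restriction is \<open>n\<close> itself, which is associative by assumption.\<close>

lemma restriction_in_TC:
  assumes "n \<in> structures sA m sQ"
  shows "restriction n \<in> TC sA m sQ"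
proof -
  have alg: "assoc_conformal_algebra sE n"
    using assms by (simp add: structures_def)
  then have bil: "conformal_bilinear sE sE sE n"
    by (simp add: assoc_conformal_algebra_def)
  have "extending_datum sA sQ (restriction n)"
    unfolding extending_datum_def restriction_def
    by (simp add: conformal_bilinear_transport[OF bil] module_hom_inl module_hom_inr
        module_hom_fst module_hom_snd)
  then show ?thesis
    using alg by (simp add: TC_def unified_product_restriction[OF assms])
qed

lemma bij_betw_unified_product:
  "bij_betw (unified_product m) (TC sA m sQ) (structures sA m sQ)"
  by (rule bij_betw_byWitness[where f' = restriction])
    (use restriction_in_TC unified_product_in_structures in
      \<open>auto simp: unified_product_restriction TC_def restriction_unified_product\<close>)

text \<open>Any such \<open>h\<close> is a module homomorphism, so only multiplicativity matters.
  Its second component gives the conditions on \<open>rharp\<close>, \<open>ltri\<close> and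
  \<open>circ\<close>, its first those on \<open>lharp\<close>, \<open>rtri\<close> and
  \<open>cocyc\<close>.\<close>

lemma unified_product_hom_iff:
  assumes W: "extending_datum sA sQ W" and W': "extending_datum sA sQ W'"
    and u: "module_hom sQ sA u" and v: "module_hom sQ sQ v" and "bij v"
    and h: "\<And>a x. h (a, x) = (a + u x, v x)"
  shows "conformal_hom sE (unified_product m W) sE (unified_product m W') h \<longleftrightarrow>
    equivalent_via m u v W W'"
proof -
  note add = conformal_bilinear_add[OF bilinear_A] extending_datum_add[OF W']
  note zero = conformal_bilinear_zero[OF bilinear_A] extending_datum_zero[OF W]
    extending_datum_zero[OF W']
  have uv0: "u 0 = 0" "v 0 = 0"
    using u v by (simp_all add: module_hom.zero)
  have "module_hom sQ sQ (inv v)"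
    using v \<open>bij v\<close> module_Q
    by (intro module_pair.bij_module_hom_imp_inv_module_hom) (simp_all add: module_pair_def)
  then have inv_add: "map_poly (inv v) (p + q) = map_poly (inv v) p + map_poly (inv v) q" for p q
    by (intro map_poly_add_hom) (simp_all add: module_hom.add module_hom.zero)
  have map_add: "map_poly u (p + q) = map_poly u p + map_poly u q"
    "map_poly v (p + q) = map_poly v p + map_poly v q" for p q
    by (simp_all add: map_poly_add_hom module_hom.add[OF u] module_hom.add[OF v] uv0)
  have hom: "module_hom sE sE h"
    by unfold_locales
      (auto simp: h scale_def module_hom.add[OF u] module_hom.add[OF v] module_hom.scale[OF u]
        module_hom.scale[OF v] m1.scale_right_distrib)
  have map_h: "map_poly h (pair_poly p q) = pair_poly (p + map_poly u q) (map_poly v q)" for p q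
    by (rule poly_eqI)
      (simp add: coeff_map_poly coeff_pair_poly module_hom.zero[OF hom] h uv0)
  have "conformal_hom sE (unified_product m W) sE (unified_product m W') h \<longleftrightarrow>
    (\<forall>a x b y.
      m a b + lharp W a y + rtri W x b + cocyc W x y
          + map_poly u (rharp W a y + ltri W x b + circ W x y)
        = m (a + u x) (b + u y) + lharp W' (a + u x) (v y) + rtri W' (v x) (b + u y)
          + cocyc W' (v x) (v y) \<and>
      map_poly v (rharp W a y + ltri W x b + circ W x y)
        = rharp W' (a + u x) (v y) + ltri W' (v x) (b + u y) + circ W' (v x) (v y))"
    (is "_ \<longleftrightarrow> (\<forall>a x b y. ?P a x b y)")
    using hom by (simp add: conformal_hom_def unified_product_def h map_h pair_poly_eq_iff)
  \<comment> \<open>The fourth pair is omitted because \<open>?P a 0 b 0\<close> reduces to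
    \<open>m a b = m a b\<close>.\<close>
  also have "\<dots> \<longleftrightarrow> (\<forall>a y. ?P a 0 0 y) \<and> (\<forall>x b. ?P 0 x b 0) \<and> (\<forall>x y. ?P 0 x 0 y)"
    (is "?all \<longleftrightarrow> ?summands")
  proof
    assume R: ?summands
    show ?all
    proof (intro allI)
      fix a x b y
      have "?P a 0 0 y" "?P 0 x b 0" "?P 0 x 0 y"
        using R[THEN conjunct1] R[THEN conjunct2, THEN conjunct1] R[THEN conjunct2, THEN conjunct2]
        by (iprover dest: spec)+
      then show "?P a x b y"
        \<comment> \<open>The general equation is the sum of the three special ones and
          \<open>m a b = m a b\<close>. Reading \<open>eq_diff_eq\<close> backwards moves the terms
          with \<open>map_poly u\<close> to the right-hand side.\<close>
        by (simp add: add zero uv0 map_add eq_diff_eq[symmetric])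
    qed
  qed simp
  also have "\<dots> \<longleftrightarrow> equivalent_via m u v W W'"
    \<comment> \<open>The three images under \<open>inv v\<close> in the condition on
      \<open>circ\<close> are first merged into one, so that \<open>v\<close> can be moved to the
      other side.\<close>
    unfolding equivalent_via_def inv_add[symmetric] map_poly_inv_eq_iff[OF \<open>bij v\<close> uv0(2)]
    by (auto simp: zero uv0 eq_diff_eq)
  finally show ?thesis .
qed

text \<open>Additivity gives \<open>h (a, x) = h (a, 0) + h (0, x)\<close>, where the first summand
  is \<open>(a, 0)\<close>. Hence \<open>u\<close> and \<open>v\<close> are the components of
  \<open>h\<close> on \<open>Q\<close>.\<close>

lemma stabilizing_hom_form:
  assumes "module_hom sE sE h" and "stabilizes h"
  obtains u v where "module_hom sQ sA u" "module_hom sQ sQ v" "\<And>a x. h (a, x) = (a + u x, v x)"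
proof
  let ?u = "\<lambda>x. fst (h (0, x))" and ?v = "\<lambda>x. snd (h (0, x))"
  show "module_hom sQ sA ?u"
    using module_hom_compose[OF module_hom_compose[OF module_hom_inr assms(1)] module_hom_fst]
    by (simp add: o_def)
  show "module_hom sQ sQ ?v"
    using module_hom_compose[OF module_hom_compose[OF module_hom_inr assms(1)] module_hom_snd]
    by (simp add: o_def)
  show "h (a, x) = (a + ?u x, ?v x)" for a x
    using module_hom.add[OF assms(1), of "(a, 0)" "(0, x)"] assms(2)
    by (simp add: stabilizes_def prod_eq_iff)
qed

text \<open>The shift of the first coordinate by \<open>u x\<close> can be undone once
  \<open>x\<close> is recovered from \<open>v x\<close>.\<close>

lemma bij_stabilizing_iff:
  assumes h: "\<And>a x. h (a, x) = (a + u x :: 'a, v x :: 'q)"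
  shows "bij h \<longleftrightarrow> bij v"
proof
  assume b: "bij h"
  have "inj v"
  proof (rule injI)
    fix x y assume "v x = v y"
    \<comment> \<open>The first coordinates are chosen to cancel the shift:
      \<open>h (- u x, x) = (0, v x)\<close>.\<close>
    then have "h (- u x, x) = h (- u y, y)"
      by (simp add: h)
    then show "x = y"
      using b by (simp add: bij_def inj_eq)
  qed
  moreover have "\<exists>x. y = v x" for y
    using b h by (metis bij_pointE prod.inject surj_pair)
  ultimately show "bij v"
    by (simp add: bij_def surj_def)
next
  assume b: "bij v"
  show "bij h"
    by (rule o_bij[where g = "\<lambda>(a, x). (a - u (inv v x), inv v x)"])
      (use b in \<open>auto simp: fun_eq_iff h bij_is_inj bij_is_surj surj_f_inv_f\<close>)
qed

text \<open>The pairs \<open>(u, v)\<close> with \<open>v\<close> bijective correspond to the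
  bijective module endomorphisms \<open>h\<close> stabilizing \<open>A\<close>, and under this
  correspondence \<open>equivalent_via\<close> is multiplicativity of \<open>h\<close>.\<close>

lemma equiv_rel_iff:
  "(W, W') \<in> equiv_rel sA m sQ \<longleftrightarrow> W \<in> TC sA m sQ \<and> W' \<in> TC sA m sQ \<and>
    (unified_product m W, unified_product m W') \<in> struct_equiv_rel sA m sQ"
proof (cases "W \<in> TC sA m sQ \<and> W' \<in> TC sA m sQ")
  case True
  then have E: "extending_datum sA sQ W" "extending_datum sA sQ W'"
    by (simp_all add: TC_def)
  let ?hom = "conformal_hom sE (unified_product m W) sE (unified_product m W')"
  have "(\<exists>u v. module_hom sQ sA u \<and> module_hom sQ sQ v \<and> bij v \<and> equivalent_via m u v W W') \<longleftrightarrow>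
    (\<exists>h. ?hom h \<and> bij h \<and> stabilizes h)" (is "?L \<longleftrightarrow> ?R")
  proof
    assume ?L
    then obtain u v where uv: "module_hom sQ sA u" "module_hom sQ sQ v" "bij v"
      and eq: "equivalent_via m u v W W'"
      by blast
    let ?h = "\<lambda>(a, x). (a + u x, v x)"
    have "?hom ?h"
      using eq by (simp add: unified_product_hom_iff[OF E uv])
    moreover have "bij ?h"
      using uv by (subst bij_stabilizing_iff[of _ u v]) auto
    moreover have "stabilizes ?h"
      using uv by (simp add: stabilizes_def module_hom.zero)
    ultimately show ?R
      by blast
  next
    assume ?R
    then obtain h where h: "?hom h" "bij h" "stabilizes h"
      by blast
    then have "module_hom sE sE h"
      by (simp add: conformal_hom_def)
    then obtain u v where uv: "module_hom sQ sA u" "module_hom sQ sQ v"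
      and form: "\<And>a x. h (a, x) = (a + u x, v x)"
      using h(3) by (rule stabilizing_hom_form) blast
    have "bij v"
      using h(2) bij_stabilizing_iff[of h, OF form] by blast
    then show ?L
      using h(1) uv unified_product_hom_iff[OF E uv _ form] by blast
  qed
  then show ?thesis
    using True by (simp add: equiv_rel_def struct_equiv_rel_def unified_product_in_structures)
qed (auto simp: equiv_rel_def)

text \<open>The same correspondence as for \<open>equiv_rel\<close>, where co-stabilizing
  \<open>Q\<close> forces \<open>v = id\<close>.\<close>

lemma cohom_rel_iff:
  "(W, W') \<in> cohom_rel sA m sQ \<longleftrightarrow> W \<in> TC sA m sQ \<and> W' \<in> TC sA m sQ \<and>
    (unified_product m W, unified_product m W') \<in> struct_cohom_rel sA m sQ"
proof (cases "W \<in> TC sA m sQ \<and> W' \<in> TC sA m sQ")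
  case True
  then have E: "extending_datum sA sQ W" "extending_datum sA sQ W'"
    by (simp_all add: TC_def)
  let ?hom = "conformal_hom sE (unified_product m W) sE (unified_product m W')"
  have "(\<exists>u. module_hom sQ sA u \<and> equivalent_via m u id W W') \<longleftrightarrow>
    (\<exists>h. ?hom h \<and> bij h \<and> stabilizes h \<and> co_stabilizes h)" (is "?L \<longleftrightarrow> ?R")
  proof
    assume ?L
    then obtain u where u: "module_hom sQ sA u" and eq: "equivalent_via m u id W W'"
      by blast
    let ?h = "\<lambda>(a, x). (a + u x, id x)"
    have "?hom ?h"
      using eq by (simp add: unified_product_hom_iff[OF E u m2.module_hom_id bij_id])
    moreover have "bij ?h"
      by (subst bij_stabilizing_iff[of _ u id]) auto
    moreover have "stabilizes ?h" "co_stabilizes ?h"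
      using u by (auto simp: stabilizes_def co_stabilizes_def module_hom.zero)
    ultimately show ?R
      by blast
  next
    assume ?R
    then obtain h where h: "?hom h" "bij h" "stabilizes h" "co_stabilizes h"
      by blast
    then have "module_hom sE sE h"
      by (simp add: conformal_hom_def)
    then obtain u v where uv: "module_hom sQ sA u" "module_hom sQ sQ v"
      and form: "\<And>a x. h (a, x) = (a + u x, v x)"
      using h(3) by (rule stabilizing_hom_form) blast
    have "v = id"
      using h(4) by (auto simp: co_stabilizes_def fun_eq_iff form)
    then have "equivalent_via m u id W W'"
      using h(1) unified_product_hom_iff[OF E uv _ form] by (metis bij_id)
    then show ?L
      using uv by blast
  qed
  then show ?thesis
    using True by (simp add: cohom_rel_def struct_cohom_rel_def unified_product_in_structures)
qed (auto simp: cohom_rel_def)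

end

section \<open>Isomorphisms of conformal algebras\<close>

lemma conformal_hom_id: "module s \<Longrightarrow> conformal_hom s n s n id"
  by (simp add: conformal_hom_def module.module_hom_id)

lemma conformal_hom_comp:
  assumes "conformal_hom s n s' n' h" and "conformal_hom s' n' s'' n'' g"
  shows "conformal_hom s n s'' n'' (g \<circ> h)"
proof -
  have hom: "module_hom s s' h" "module_hom s' s'' g"
    using assms by (auto simp: conformal_hom_def)
  have "map_poly (g \<circ> h) p = map_poly g (map_poly h p)" for p
    by (simp add: map_poly_map_poly module_hom.zero[OF hom(1)] module_hom.zero[OF hom(2)])
  then show ?thesis
    using assms module_hom_compose[OF hom] by (simp add: conformal_hom_def)
qed

text \<open>Applying \<open>h\<close> to \<open>n (inv h x) (inv h y)\<close> gives
  \<open>n' x y\<close> by multiplicativity; \<open>map_poly_inv_eq_iff\<close> turns this into the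
  claim for \<open>inv h\<close>.\<close>

lemma conformal_hom_inv:
  assumes h: "conformal_hom s n s' n' h" and "bij h"
  shows "conformal_hom s' n' s n (inv h)"
proof -
  have hom: "module_hom s s' h"
    using h by (simp add: conformal_hom_def)
  interpret module_pair s s'
    using hom by (simp add: module_pair_def module_hom_iff)
  have "n (inv h x) (inv h y) = map_poly (inv h) (n' x y)" for x y
    using h \<open>bij h\<close> module_hom.zero[OF hom]
    by (simp add: map_poly_inv_eq_iff conformal_hom_def bij_is_surj surj_f_inv_f)
  then show ?thesis
    using bij_module_hom_imp_inv_module_hom[OF hom \<open>bij h\<close>] by (simp add: conformal_hom_def)
qed

lemma stabilizes_inv: "bij h \<Longrightarrow> stabilizes h \<Longrightarrow> stabilizes (inv h)"
  by (metis stabilizes_def bij_is_inj inv_f_f)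

lemma co_stabilizes_inv: "bij h \<Longrightarrow> co_stabilizes h \<Longrightarrow> co_stabilizes (inv h)"
  by (metis co_stabilizes_def bij_is_surj comp_assoc comp_id surj_iff)

context conformal_extension
begin

text \<open>The isomorphisms stabilizing \<open>A\<close> contain the identities and are closed
  under inverses and composition.\<close>

lemma equiv_struct_equiv_rel: "equiv (structures sA m sQ) (struct_equiv_rel sA m sQ)"
proof (rule equivI)
  show "struct_equiv_rel sA m sQ \<subseteq> structures sA m sQ \<times> structures sA m sQ"
    by (auto simp: struct_equiv_rel_def)
  show "refl_on (structures sA m sQ) (struct_equiv_rel sA m sQ)"
    using conformal_hom_id[OF p.module_axioms]
    by (fastforce simp: refl_on_def struct_equiv_rel_def stabilizes_def)
  show "sym (struct_equiv_rel sA m sQ)"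
    by (rule symI)
      (auto simp: struct_equiv_rel_def intro: conformal_hom_inv bij_imp_bij_inv stabilizes_inv)
  show "trans (struct_equiv_rel sA m sQ)"
  proof (rule transI)
    fix n n' n''
    assume "(n, n') \<in> struct_equiv_rel sA m sQ" "(n', n'') \<in> struct_equiv_rel sA m sQ"
    then obtain h g where "n \<in> structures sA m sQ" "n'' \<in> structures sA m sQ"
      "conformal_hom sE n sE n' h" "bij h" "stabilizes h"
      "conformal_hom sE n' sE n'' g" "bij g" "stabilizes g"
      by (auto simp: struct_equiv_rel_def)
    then have "n \<in> structures sA m sQ \<and> n'' \<in> structures sA m sQ \<and>
      conformal_hom sE n sE n'' (g \<circ> h) \<and> bij (g \<circ> h) \<and> stabilizes (g \<circ> h)"
      by (auto simp: stabilizes_def intro: conformal_hom_comp bij_comp)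
    then show "(n, n'') \<in> struct_equiv_rel sA m sQ"
      unfolding struct_equiv_rel_def by blast
  qed
qed

lemma equiv_struct_cohom_rel: "equiv (structures sA m sQ) (struct_cohom_rel sA m sQ)"
proof (rule equivI)
  show "struct_cohom_rel sA m sQ \<subseteq> structures sA m sQ \<times> structures sA m sQ"
    by (auto simp: struct_cohom_rel_def)
  show "refl_on (structures sA m sQ) (struct_cohom_rel sA m sQ)"
    using conformal_hom_id[OF p.module_axioms]
    by (fastforce simp: refl_on_def struct_cohom_rel_def stabilizes_def co_stabilizes_def)
  show "sym (struct_cohom_rel sA m sQ)"
    by (rule symI)
      (auto simp: struct_cohom_rel_def
        intro: conformal_hom_inv bij_imp_bij_inv stabilizes_inv co_stabilizes_inv)
  show "trans (struct_cohom_rel sA m sQ)"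
  proof (rule transI)
    fix n n' n''
    assume "(n, n') \<in> struct_cohom_rel sA m sQ" "(n', n'') \<in> struct_cohom_rel sA m sQ"
    then obtain h g where "n \<in> structures sA m sQ" "n'' \<in> structures sA m sQ"
      "conformal_hom sE n sE n' h" "bij h" "stabilizes h" "co_stabilizes h"
      "conformal_hom sE n' sE n'' g" "bij g" "stabilizes g" "co_stabilizes g"
      by (auto simp: struct_cohom_rel_def)
    then have "n \<in> structures sA m sQ \<and> n'' \<in> structures sA m sQ \<and>
      conformal_hom sE n sE n'' (g \<circ> h) \<and> bij (g \<circ> h) \<and> stabilizes (g \<circ> h) \<and>
      co_stabilizes (g \<circ> h)"
      by (auto simp: stabilizes_def co_stabilizes_def comp_assoc[symmetric]
          intro: conformal_hom_comp bij_comp)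
    then show "(n, n'') \<in> struct_cohom_rel sA m sQ"
      unfolding struct_cohom_rel_def by blast
  qed
qed

end

theorem theorem3p7:
  fixes sA :: "complex poly \<Rightarrow> 'a::ab_group_add \<Rightarrow> 'a"
    and sQ :: "complex poly \<Rightarrow> 'q::ab_group_add \<Rightarrow> 'q"
    and m :: "'a \<Rightarrow> 'a \<Rightarrow> 'a poly"
  assumes "assoc_conformal_algebra sA m"
    and "module sQ"
  shows "(equiv (TC sA m sQ) (equiv_rel sA m sQ) \<and>
         equiv (structures sA m sQ) (struct_equiv_rel sA m sQ) \<and>
         (\<exists>F. (\<forall>W \<in> TC sA m sQ.
                 F (equiv_rel sA m sQ `` {W}) = struct_equiv_rel sA m sQ `` {unified_product m W}) \<and>
              bij_betw F (AH2_A sA m sQ) (CExtd sA m sQ))) \<and>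
         (equiv (TC sA m sQ) (cohom_rel sA m sQ) \<and>
         equiv (structures sA m sQ) (struct_cohom_rel sA m sQ) \<and>
         (\<exists>F. (\<forall>W \<in> TC sA m sQ.
                 F (cohom_rel sA m sQ `` {W}) = struct_cohom_rel sA m sQ `` {unified_product m W}) \<and>
              bij_betw F (AH2 sA m sQ) (CExtd' sA m sQ)))"
proof -
  interpret conformal_extension sA sQ m
    using assms by (rule conformal_extension.intro)
  \<comment> \<open>The pullback form that \<open>equiv_pullback_bij_betw\<close> requires. It then
    yields both the equivalence property on \<open>TC\<close> and the bijection between the
    quotients.\<close>
  have "equiv_rel sA m sQ = {(W, W'). W \<in> TC sA m sQ \<and> W' \<in> TC sA m sQ \<and>
      (unified_product m W, unified_product m W') \<in> struct_equiv_rel sA m sQ}"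
    by (auto simp: equiv_rel_iff)
  note E = equiv_pullback_bij_betw[OF bij_betw_unified_product equiv_struct_equiv_rel this]
  have "cohom_rel sA m sQ = {(W, W'). W \<in> TC sA m sQ \<and> W' \<in> TC sA m sQ \<and>
      (unified_product m W, unified_product m W') \<in> struct_cohom_rel sA m sQ}"
    by (auto simp: cohom_rel_iff)
  note C = equiv_pullback_bij_betw[OF bij_betw_unified_product equiv_struct_cohom_rel this]
  show ?thesis
    unfolding AH2_A_def CExtd_def AH2_def CExtd'_def
    using E C equiv_struct_equiv_rel equiv_struct_cohom_rel by blast
qed

end
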